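(* Let $1<p<\infty$ and $\alpha\in\mathbb{R}$. There is a constant $C_{p,\alpha}$, depending only on $p$ and $\alpha$, such that for every domain $\Omega\subsetneq\mathbb{C}$ and every analytic function $g$ in $\Omega$, $$ \int_\Omega |g'(z)|^p\delta(z)^{\alpha+p}\,dA(z)\le C_{p,\alpha}\int_\Omega |g(z)|^p\delta(z)^\alpha\,dA(z). $$ Consequently, with a (possibly different) constant $C_{p,\alpha}$ depending only on $p$ and $\alpha$, for every $z_0\in\Omega$, $$ |g(z_0)|^p\delta(z_0)^{\alpha+2}+\int_\Omega |g'(z)|^p\delta(z)^{\alpha+p}\,dA(z)\le C_{p,\alpha}\int_\Omega |g(z)|^p\delta(z)^\alpha\,dA(z). $$
   Context: $\delta(z)=\operatorname{dist}(z,\partial\Omega)$ is the Euclidean distance to the boundary and $dA=dx\,dy$ is Euclidean area measure. A domain is a nonempty connected open set (not assumed bounded here). Inequalities involving possibly infinite integrals are understood in the extended sense (values in $[0,\infty]$). *)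

theory Defs
  imports "HOL-Complex_Analysis.Complex_Analysis"
begin

definition complex_domain :: "complex set \<Rightarrow> bool" where
  "complex_domain \<Omega> \<longleftrightarrow> \<Omega> \<noteq> {} \<and> open \<Omega> \<and> connected \<Omega>"

(* infdist is 0 by convention when the set is empty; here the frontier is nonempty
   whenever the domain is a proper subset of the plane. *)
definition bdry_dist :: "complex set \<Rightarrow> complex \<Rightarrow> real" where
  "bdry_dist \<Omega> z = infdist z (frontier \<Omega>)"

(* Integral of |f|^p * dist(., boundary)^beta over the domain with respect to area measure
   (lborel on the complex plane), with values in [0, infinity]. *)
definition weighted_integral :: "complex set \<Rightarrow> real \<Rightarrow> real \<Rightarrow> (complex \<Rightarrow> complex) \<Rightarrow> ennreal" where
  "weighted_integral \<Omega> p \<beta> f =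
     (\<integral>\<^sup>+ z\<in>\<Omega>. ennreal (norm (f z) powr p * bdry_dist \<Omega> z powr \<beta>) \<partial>lborel)"

end

theory Submission
  imports Defs
begin

text \<open>
  Cauchy's formula on circles gives the circular mean value property, and Young's inequality turns
  it into a submean inequality for \<open>|g|\<^sup>p\<close>. Averaging over all circles, by rotation invariance of
  Lebesgue measure, bounds \<open>|g(z)|\<^sup>p\<close> by the mean of \<open>|g|\<^sup>p\<close> over a disc; Cauchy's inequality on a
  smaller circle then bounds \<open>|g'(z)|\<^sup>p\<close>. On the disc of radius \<open>\<delta>(z)/2\<close> about \<open>z\<close> the weight is
  comparable to \<open>\<delta>(z)\<close>, so both inequalities follow, the first one by Tonelli's theorem: the points
  \<open>z\<close> whose disc contains \<open>w\<close> lie within distance \<open>\<delta>(w)\<close> of \<open>w\<close>.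
\<close>

section \<open>Invariance of Lebesgue measure under orthogonal maps\<close>

lemma lborel_distr_orthogonal_transformation:
  fixes T :: "'a::euclidean_space \<Rightarrow> 'a"
  assumes T: "orthogonal_transformation T"
  shows "distr lborel borel T = (lborel :: 'a measure)"
proof (rule measure_eqI)
  show "sets (distr lborel borel T) = sets (lborel :: 'a measure)" by simp
next
  fix B assume "B \<in> sets (distr lborel borel T)"
  then have B[measurable]: "B \<in> sets borel" by simp
  define U where "U = ball (0::'a) 1"
  have U[measurable]: "U \<in> sets borel" by (simp add: U_def)
  have lin: "linear T" using T by (rule orthogonal_transformation_linear)
  have T_meas[measurable]: "T \<in> borel_measurable borel"
    by (intro borel_measurable_continuous_onI linear_continuous_on linear_linear[THEN iffD2] lin)
  have norm_T: "norm (T x) = norm x" for x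
    using T by (rule orthogonal_transformation_norm)
  have shift: "(\<integral>\<^sup>+x. f (a + x) \<partial>lborel) = (\<integral>\<^sup>+x. f x \<partial>lborel)"
    if [measurable]: "f \<in> borel_measurable borel" for f and a :: 'a
    by (subst (2) lborel_distr_plus[of a, symmetric]) (simp add: nn_integral_distr)
  \<comment> \<open>Surjectivity writes \<open>a\<close> as \<open>T b\<close>, so a translation
    outside \<open>T\<close> becomes a translation of the variable inside it.\<close>
  have shift_T: "(\<integral>\<^sup>+x. f (a + T x) \<partial>lborel) = (\<integral>\<^sup>+x. f (T x) \<partial>lborel)"
    if [measurable]: "f \<in> borel_measurable borel" for f and a :: 'a
  proof -
    obtain b where a: "a = T b"
      using orthogonal_transformation_surj[OF T] by (metis surjD)
    have "(\<integral>\<^sup>+x. f (a + T x) \<partial>lborel) = (\<integral>\<^sup>+x. f (T (b + x)) \<partial>lborel)"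
      by (simp add: a linear_add[OF lin])
    also have "\<dots> = (\<integral>\<^sup>+x. f (T x) \<partial>lborel)"
      by (rule shift) simp
    finally show ?thesis .
  qed
  \<comment> \<open>Uniqueness of translation-invariant measures by Tonelli's theorem: \<open>T\<close> maps the unit ball \<open>U\<close> to
     itself, so the constant of proportionality is 1.\<close>
  have "emeasure lborel U * (\<integral>\<^sup>+y. indicator B (T y) \<partial>lborel)
      = (\<integral>\<^sup>+x. indicator U x * (\<integral>\<^sup>+y. indicator B (T y) \<partial>lborel) \<partial>lborel)"
    by (simp add: nn_integral_multc)
  also have "\<dots> = (\<integral>\<^sup>+x. indicator U x * (\<integral>\<^sup>+y. indicator B (x + T y) \<partial>lborel) \<partial>lborel)"
    by (subst shift_T[of "indicator B"]) simp_all
  also have "\<dots> = (\<integral>\<^sup>+x. (\<integral>\<^sup>+y. indicator U x * indicator B (x + T y) \<partial>lborel) \<partial>lborel)"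
    by (simp add: nn_integral_cmult)
  also have "\<dots> = (\<integral>\<^sup>+y. (\<integral>\<^sup>+x. indicator U x * indicator B (x + T y) \<partial>lborel) \<partial>lborel)"
    by (rule lborel_pair.Fubini') measurable
  \<comment> \<open>Replacing \<open>x\<close> by \<open>x - T y\<close> moves the dependence on
    \<open>y\<close> from \<open>B\<close> to \<open>U\<close>. After exchanging the integrals
    again, the two indicators separate.\<close>
  also have "\<dots> = (\<integral>\<^sup>+y. (\<integral>\<^sup>+x. indicator U (x - T y) * indicator B x \<partial>lborel) \<partial>lborel)"
  proof (rule nn_integral_cong)
    fix y
    show "(\<integral>\<^sup>+x. indicator U x * indicator B (x + T y) \<partial>lborel)
        = (\<integral>\<^sup>+x. indicator U (x - T y) * indicator B x \<partial>lborel)"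
      using shift[of "\<lambda>x. indicator U (x - T y) * indicator B x" "T y"]
      by (simp add: add.commute)
  qed
  also have "\<dots> = (\<integral>\<^sup>+x. (\<integral>\<^sup>+y. indicator U (x - T y) * indicator B x \<partial>lborel) \<partial>lborel)"
    by (rule lborel_pair.Fubini'[symmetric]) measurable
  also have "\<dots> = (\<integral>\<^sup>+x. (\<integral>\<^sup>+y. indicator U (x - T y) \<partial>lborel) * indicator B x \<partial>lborel)"
    by (simp add: nn_integral_multc)
  also have "\<dots> = (\<integral>\<^sup>+x. emeasure lborel U * indicator B x \<partial>lborel)"
  proof (rule nn_integral_cong)
    fix x
    \<comment> \<open>The ball is symmetric under negation, translations drop out, and
      \<open>T\<close> preserves norms. Hence the inner integral is the volume of \<open>U\<close>
      whatever \<open>x\<close> is.\<close>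
    have "(\<integral>\<^sup>+y. indicator U (x - T y) \<partial>lborel) = (\<integral>\<^sup>+y. indicator U (- x + T y) \<partial>lborel)"
      by (rule nn_integral_cong) (simp add: U_def indicator_def norm_minus_commute)
    also have "\<dots> = (\<integral>\<^sup>+y. indicator U (T y) \<partial>lborel)"
      by (rule shift_T) simp
    also have "\<dots> = (\<integral>\<^sup>+y. indicator U y \<partial>lborel)"
      by (rule nn_integral_cong) (simp add: U_def indicator_def norm_T)
    finally show "(\<integral>\<^sup>+y. indicator U (x - T y) \<partial>lborel) * indicator B x
        = emeasure lborel U * indicator B x" by simp
  qed
  also have "\<dots> = emeasure lborel U * emeasure lborel B"
    by (simp add: nn_integral_cmult)
  finally have "emeasure lborel U * (\<integral>\<^sup>+y. indicator B (T y) \<partial>lborel)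
      = emeasure lborel U * emeasure lborel B" .
  moreover have "emeasure lborel U \<noteq> 0"
    unfolding U_def by (simp add: emeasure_ball unit_ball_vol_pos[THEN less_imp_neq, THEN not_sym])
  moreover have "emeasure lborel U \<noteq> \<infinity>"
    using emeasure_lborel_ball_finite[of "0::'a" 1] unfolding U_def by (metis less_irrefl)
  ultimately have "(\<integral>\<^sup>+y. indicator B (T y) \<partial>lborel) = emeasure lborel B"
    by (simp add: ennreal_mult_cancel_left)
  moreover have "(\<integral>\<^sup>+y. indicator B (T y) \<partial>lborel) = emeasure (distr lborel borel T) B"
    using nn_integral_distr[of T lborel borel "indicator B"] by simp
  ultimately show "emeasure (distr lborel borel T) B = emeasure lborel B" by simp
qed

section \<open>Submean value inequalities for powers of the modulus\<close>

text \<open>Young's inequality for \<open>x\<close> and \<open>a powr (p - 1)\<close>, with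
  conjugate exponents \<open>p\<close> and \<open>q\<close>, is the convexity of the power function,
  and it covers \<open>a = 0\<close> and \<open>x = 0\<close> as well. Integrating such a tangent
  line yields Jensen's inequality.\<close>

lemma powr_ge_tangent:
  fixes a x p :: real
  assumes "1 < p" "0 \<le> a" "0 \<le> x"
  shows "a powr p + p * a powr (p - 1) * (x - a) \<le> x powr p"
proof -
  define q where "q = p / (p - 1)"
  have q: "1 < q" "1 / p + 1 / q = 1" "(p - 1) * q = p" "p / q = p - 1"
    using assms by (auto simp: q_def field_simps)
  have "x * a powr (p - 1) \<le> x powr p / p + (a powr (p - 1)) powr q / q"
    using assms q by (intro Youngs_inequality) auto
  then have "p * (x * a powr (p - 1)) \<le> p * (x powr p / p + a powr p / q)"
    using assms q by (simp add: powr_powr mult_left_mono)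
  also have "\<dots> = x powr p + (p - 1) * a powr p"
  proof -
    have "p * (a powr p / q) = p / q * a powr p" by simp
    then show ?thesis using assms unfolding q(4) by (simp add: distrib_left)
  qed
  finally have "p * (x * a powr (p - 1)) \<le> x powr p + (p - 1) * a powr p" .
  moreover have "a powr (p - 1) * a = a powr p"
    using assms by (cases "a = 0") (auto simp: powr_diff)
  ultimately show ?thesis by (simp add: algebra_simps)
qed

text \<open>This is Jensen's inequality applied to the mean value property. The circle is given by a
  point \<open>z + w\<close> on it instead of by a radius, so that \<open>w\<close> can later be
  integrated over a disc while each fixed \<open>t\<close> acts on it as a rotation.\<close>

lemma powr_norm_mean_value_circle:
  assumes hol: "f holomorphic_on ball z R" and w: "norm w < R" and p: "1 < p"
  shows "ennreal (norm (f z) powr p)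
    \<le> (\<integral>\<^sup>+t\<in>{0..1}. ennreal (norm (f (z + w * exp (2 * of_real pi * \<i> * of_real t))) powr p) \<partial>lborel)"
proof -
  \<comment> \<open>Rescaling to the unit circle keeps \<open>w = 0\<close> as an ordinary case, in
    which \<open>F\<close> is constant.\<close>
  define F where "F = (\<lambda>u. f (z + w * u))"
  define e where "e = (\<lambda>t::real. exp (2 * of_real pi * \<i> * of_real t) :: complex)"
  have norm_e: "norm (e t) = 1" for t
    by (simp add: e_def norm_exp_eq_Re)
  have in_ball: "z + w * u \<in> ball z R" if "norm u \<le> 1" for u
    using w mult_left_mono[OF that, of "norm w"] by (simp add: dist_norm norm_mult)
  have "(f \<circ> (\<lambda>u. z + w * u)) holomorphic_on cball 0 1"
    by (rule holomorphic_on_compose_gen[OF _ hol]) (auto intro!: holomorphic_intros in_ball)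
  then have "F holomorphic_on cball 0 1"
    by (simp add: F_def o_def)
  then have "((\<lambda>u. F u / (u - 0)) has_contour_integral (2 * of_real pi * \<i> * F 0)) (circlepath 0 1)"
    by (rule Cauchy_integral_circlepath_simple) simp
  then have "((\<lambda>t. F (e t) / e t * vector_derivative (circlepath 0 1) (at t within {0..1}))
      has_integral (2 * of_real pi * \<i> * F 0)) {0..1}"
    by (simp add: has_contour_integral_def circlepath e_def)
  \<comment> \<open>The circle has derivative \<open>2 * pi * \<i> * e t\<close>, whose factor
    \<open>e t\<close> cancels the denominator of the Cauchy kernel.\<close>
  then have "((\<lambda>t. 2 * of_real pi * \<i> * F (e t)) has_integral (2 * of_real pi * \<i> * F 0)) {0..1}"
    by (rule has_integral_eq[rotated]) (simp add: vector_derivative_circlepath01 e_def)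
  then have "((\<lambda>t. inverse (2 * of_real pi * \<i>) * (2 * of_real pi * \<i> * F (e t)))
      has_integral inverse (2 * of_real pi * \<i>) * (2 * of_real pi * \<i> * F 0)) {0..1}"
    by (rule has_integral_mult_right)
  moreover have "inverse (2 * of_real pi * \<i>) * (2 * of_real pi * \<i> * x) = x" for x :: complex
    by (simp add: field_simps)
  ultimately have mean: "((\<lambda>t. F (e t)) has_integral F 0) {0..1}"
    by (simp only:)
  have contF: "continuous_on {0..1} (\<lambda>t. F (e t))"
  proof -
    have "continuous_on {0..1} (\<lambda>t. f (z + w * e t))"
    proof (rule continuous_on_compose2[OF holomorphic_on_imp_continuous_on[OF hol]])
      show "continuous_on {0..1} (\<lambda>t. z + w * e t)"
        unfolding e_def by (intro continuous_intros)
      show "(\<lambda>t. z + w * e t) ` {0..1} \<subseteq> ball z R"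
        using in_ball norm_e by auto
    qed
    then show ?thesis by (simp add: F_def)
  qed
  define a where "a = norm (F 0)"
  define n where "n = (\<lambda>t. norm (F (e t)))"
  have contn: "continuous_on {0..1} n"
    unfolding n_def by (intro continuous_intros contF)
  have n_int: "n integrable_on {0..1}"
    by (rule integrable_continuous_interval[OF contn])
  have contnp: "continuous_on {0..1} (\<lambda>t. n t powr p)"
    using p by (intro continuous_on_powr' contn continuous_on_const) (auto simp: n_def)
  have np_int: "(\<lambda>t. n t powr p) integrable_on {0..1}"
    by (rule integrable_continuous_interval[OF contnp])
  have "norm (integral {0..1} (\<lambda>t. F (e t))) \<le> integral {0..1} n"
    by (rule integral_norm_bound_integral)
       (use mean n_int in \<open>auto simp: n_def has_integral_iff\<close>)
  then have a_le: "a \<le> integral {0..1} n"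
    using mean by (simp add: a_def has_integral_iff)
  \<comment> \<open>The tangent at \<open>a\<close>, the modulus at the centre, is integrated along
    \<open>n\<close>. Its linear term has nonnegative integral, because the slope is nonnegative and
    the mean of \<open>n\<close> is at least \<open>a\<close>.\<close>
  have "((\<lambda>t. a powr p + p * a powr (p - 1) * (n t - a)) has_integral
      (a powr p + p * a powr (p - 1) * (integral {0..1} n - a))) {0..1}"
    using has_integral_const_real[of "a powr p" 0 1] has_integral_const_real[of a 0 1]
    by (intro has_integral_add has_integral_mult_right has_integral_diff integrable_integral n_int) auto
  then have "a powr p + p * a powr (p - 1) * (integral {0..1} n - a)
      \<le> integral {0..1} (\<lambda>t. n t powr p)"
    by (rule has_integral_le[OF _ integrable_integral[OF np_int]])
       (use p in \<open>auto intro!: powr_ge_tangent simp: a_def n_def\<close>)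
  moreover have "0 \<le> p * a powr (p - 1) * (integral {0..1} n - a)"
    using a_le p by (intro mult_nonneg_nonneg) auto
  ultimately have "a powr p \<le> integral {0..1} (\<lambda>t. n t powr p)" by linarith
  then have "ennreal (a powr p) \<le> ennreal (integral {0..1} (\<lambda>t. n t powr p))"
    by (rule ennreal_leI)
  also have "\<dots> = (\<integral>\<^sup>+t\<in>{0..1}. ennreal (n t powr p) \<partial>lborel)"
    by (rule nn_integral_has_integral_lebesgue'[symmetric])
       (auto intro: integrable_integral np_int)
  finally show ?thesis
    by (simp add: a_def n_def F_def e_def)
qed

text \<open>Off \<open>S\<close> the function \<open>f\<close> is arbitrary and possibly not
  measurable. Cutting \<open>f\<close> off before taking the power makes it Borel and leaves the
  product with the indicator unchanged.\<close>

lemma borel_measurable_powr_norm_on_open: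
  fixes f :: "complex \<Rightarrow> complex" and b :: "complex \<Rightarrow> real"
  assumes "open S" "continuous_on S f" "b \<in> borel_measurable borel"
  shows "(\<lambda>w. ennreal (norm (f w) powr p * b w) * indicator S w) \<in> borel_measurable borel"
proof -
  have [measurable]: "(\<lambda>w. indicator S w *\<^sub>R f w) \<in> borel_measurable borel"
    using assms by (intro borel_measurable_continuous_on_indicator) auto
  have [measurable]: "S \<in> sets borel" "b \<in> borel_measurable borel"
    using assms by auto
  have "(\<lambda>w. ennreal (norm (indicator S w *\<^sub>R f w) powr p * b w) * indicator S w)
      \<in> borel_measurable borel"
    by measurable
  also have "(\<lambda>w. ennreal (norm (indicator S w *\<^sub>R f w) powr p * b w) * indicator S w)
      = (\<lambda>w. ennreal (norm (f w) powr p * b w) * indicator S w)"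
    by (auto simp: indicator_def fun_eq_iff)
  finally show ?thesis .
qed

lemma emeasure_complex_ball:
  assumes "0 \<le> r"
  shows "emeasure lborel (ball (z::complex) r) = ennreal (pi * r\<^sup>2)"
  using assms by (simp add: emeasure_ball unit_ball_vol_2)

text \<open>The circle inequality is integrated over all \<open>w\<close> in the disc and the order
  of integration exchanged. For fixed \<open>t\<close> the integrand in \<open>w\<close> is a
  rotated copy of \<open>h\<close>, so every angle contributes the same integral; this takes the
  place of polar coordinates.\<close>

lemma powr_norm_mean_value_ball:
  assumes hol: "f holomorphic_on ball z r" and r: "0 \<le> r" and p: "1 < p"
  shows "ennreal (pi * r\<^sup>2) * ennreal (norm (f z) powr p)
    \<le> (\<integral>\<^sup>+w\<in>ball z r. ennreal (norm (f w) powr p) \<partial>lborel)"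
proof -
  define e where "e = (\<lambda>t::real. exp (2 * of_real pi * \<i> * of_real t) :: complex)"
  have [measurable]: "e \<in> borel_measurable borel"
    unfolding e_def by (intro borel_measurable_continuous_onI continuous_intros)
  have norm_e: "norm (e t) = 1" for t
    by (simp add: e_def norm_exp_eq_Re)
  \<comment> \<open>Extension by zero gives a Borel function on the whole plane, which
    \<open>h\<close> then recentres at the origin so that rotations act on it.\<close>
  define k where "k = (\<lambda>w. ennreal (norm (f w) powr p) * indicator (ball z r) w)"
  have k_meas[measurable]: "k \<in> borel_measurable borel"
    using borel_measurable_powr_norm_on_open[of "ball z r" f "\<lambda>_. 1" p]
      holomorphic_on_imp_continuous_on[OF hol] by (simp add: k_def)
  define h where "h = (\<lambda>w. k (z + w))"
  have h_meas[measurable]: "h \<in> borel_measurable borel"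
    unfolding h_def by measurable
  have rot: "(\<integral>\<^sup>+w. h (w * e t) \<partial>lborel) = (\<integral>\<^sup>+w. h w \<partial>lborel)" for t
  proof -
    have "orthogonal_transformation (\<lambda>w. w * e t)"
      unfolding orthogonal_transformation
      by (auto simp: norm_mult norm_e intro!: linearI simp: algebra_simps)
    note D = lborel_distr_orthogonal_transformation[OF this]
    show ?thesis
      by (subst (2) D[symmetric]) (simp add: nn_integral_distr)
  qed
  have "ennreal (pi * r\<^sup>2) * ennreal (norm (f z) powr p)
      = (\<integral>\<^sup>+w. ennreal (norm (f z) powr p) * indicator (ball (0::complex) r) w \<partial>lborel)"
    using r by (subst nn_integral_cmult_indicator) (simp_all add: emeasure_complex_ball mult.commute)
  also have "\<dots> \<le> (\<integral>\<^sup>+w. (\<integral>\<^sup>+t. h (w * e t) * indicator {0..1} t \<partial>lborel) \<partial>lborel)"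
  proof (rule nn_integral_mono)
    fix w :: complex
    show "ennreal (norm (f z) powr p) * indicator (ball 0 r) w
      \<le> (\<integral>\<^sup>+t. h (w * e t) * indicator {0..1} t \<partial>lborel)"
    proof (cases "norm w < r")
      case True
      have "h (w * e t) = ennreal (norm (f (z + w * e t)) powr p)" for t
        using True by (simp add: h_def k_def dist_norm norm_mult norm_e)
      then show ?thesis
        using powr_norm_mean_value_circle[OF hol True p] True by (simp add: e_def)
    qed simp
  qed
  also have "\<dots> = (\<integral>\<^sup>+t. (\<integral>\<^sup>+w. h (w * e t) * indicator {0..1} t \<partial>lborel) \<partial>lborel)"
    by (rule lborel_pair.Fubini'[symmetric]) measurable
  also have "\<dots> = (\<integral>\<^sup>+t. (\<integral>\<^sup>+w. h w \<partial>lborel) * indicator {0..1} (t::real) \<partial>lborel)"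
    by (simp add: nn_integral_multc rot)
  also have "\<dots> = (\<integral>\<^sup>+w. k (z + w) \<partial>lborel)"
    by (simp add: nn_integral_cmult h_def)
  also have "\<dots> = (\<integral>\<^sup>+w. k w \<partial>lborel)"
    by (subst (2) lborel_distr_plus[of z, symmetric]) (simp add: nn_integral_distr)
  finally show ?thesis by (simp add: k_def)
qed

text \<open>Cauchy's inequality bounds \<open>s * norm (deriv f z)\<close> by the modulus of
  \<open>f\<close> at a maximum point \<open>x\<close> of the sphere of radius \<open>s\<close>. The
  disc of radius \<open>s\<close> about \<open>x\<close> stays within distance \<open>2 * s\<close>
  of \<open>z\<close>, which explains the doubled radius.\<close>

lemma powr_norm_deriv_mean_value_ball:
  assumes hol: "f holomorphic_on ball z (2 * s)" and s: "0 < s" and p: "1 < p"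
  shows "ennreal (pi * s\<^sup>2) * ennreal ((s * norm (deriv f z)) powr p)
    \<le> (\<integral>\<^sup>+w\<in>ball z (2 * s). ennreal (norm (f w) powr p) \<partial>lborel)"
proof -
  have cont: "continuous_on (cball z s) f"
    by (rule holomorphic_on_imp_continuous_on[OF holomorphic_on_subset[OF hol]]) (use s in auto)
  have "continuous_on (sphere z s) (\<lambda>w. norm (f w))"
    by (intro continuous_intros continuous_on_subset[OF cont]) auto
  then obtain x where x: "x \<in> sphere z s"
    and x_max: "\<And>y. y \<in> sphere z s \<Longrightarrow> norm (f y) \<le> norm (f x)"
    using continuous_attains_sup[of "sphere z s" "\<lambda>w. norm (f w)"] s by auto
  have "norm ((deriv ^^ 1) f z) \<le> fact 1 * norm (f x) / s ^ 1"
    by (rule Cauchy_inequality[OF holomorphic_on_subset[OF hol] cont s])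
       (use s x_max in \<open>auto simp: dist_norm\<close>)
  then have "s * norm (deriv f z) \<le> norm (f x)"
    using s by (simp add: field_simps)
  then have "ennreal (pi * s\<^sup>2) * ennreal ((s * norm (deriv f z)) powr p)
      \<le> ennreal (pi * s\<^sup>2) * ennreal (norm (f x) powr p)"
    using s p by (intro mult_left_mono ennreal_leI powr_mono2) auto
  also have sub: "ball x s \<subseteq> ball z (2 * s)"
    using x by (intro subsetI) (simp, smt (verit) dist_triangle)
  have "ennreal (pi * s\<^sup>2) * ennreal (norm (f x) powr p)
      \<le> (\<integral>\<^sup>+w\<in>ball x s. ennreal (norm (f w) powr p) \<partial>lborel)"
    by (rule powr_norm_mean_value_ball[OF holomorphic_on_subset[OF hol sub]]) (use s p in auto)
  also have "\<dots> \<le> (\<integral>\<^sup>+w\<in>ball z (2 * s). ennreal (norm (f w) powr p) \<partial>lborel)"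
    by (rule nn_set_integral_set_mono[OF sub])
  finally show ?thesis .
qed

section \<open>Distance to the boundary and comparability of weights\<close>

lemma bdry_dist_pos:
  assumes "complex_domain \<Omega>" "\<Omega> \<noteq> UNIV" "z \<in> \<Omega>"
  shows "0 < bdry_dist \<Omega> z"
  unfolding bdry_dist_def using assms
  by (intro infdist_pos_not_in_closed frontier_not_empty)
     (auto simp: complex_domain_def frontier_def interior_open)

text \<open>A ball is connected, so one that meets both \<Omega> and its complement meets the
  frontier, here at a point closer to \<open>z\<close> than the boundary distance allows.\<close>

lemma ball_bdry_dist_subset:
  assumes "complex_domain \<Omega>" "z \<in> \<Omega>"
  shows "ball z (bdry_dist \<Omega> z) \<subseteq> \<Omega>"
proof (rule ccontr)
  assume "\<not> ball z (bdry_dist \<Omega> z) \<subseteq> \<Omega>"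
  moreover from this have "0 < bdry_dist \<Omega> z"
    by (metis ball_empty empty_subsetI linorder_not_le)
  ultimately have "ball z (bdry_dist \<Omega> z) \<inter> frontier \<Omega> \<noteq> {}"
    using centre_in_ball[of z "bdry_dist \<Omega> z"] assms(2)
    by (intro connected_Int_frontier connected_ball) blast+
  then obtain y where "y \<in> frontier \<Omega>" "dist z y < bdry_dist \<Omega> z" by auto
  then show False
    using infdist_le[of y "frontier \<Omega>" z] by (simp add: bdry_dist_def)
qed

lemma bdry_dist_le_add: "bdry_dist \<Omega> z \<le> bdry_dist \<Omega> w + dist z w"
  unfolding bdry_dist_def by (rule infdist_triangle)

lemma borel_measurable_bdry_dist [measurable]: "bdry_dist \<Omega> \<in> borel_measurable borel"
  unfolding bdry_dist_def
  by (intro borel_measurable_continuous_onI continuous_on_infdist continuous_on_id)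

text \<open>The power is increasing or decreasing in its base according to the sign of \<beta>, and
  each case uses one of the two comparisons. The absolute value in the exponent gives one constant
  for both signs.\<close>

lemma powr_le_powr_abs_mult:
  fixes x y \<beta> :: real
  assumes "0 < x" "x \<le> 2 * y" "y \<le> 2 * x"
  shows "x powr \<beta> \<le> 2 powr \<bar>\<beta>\<bar> * y powr \<beta>"
proof (cases "0 \<le> \<beta>")
  case True
  then have "x powr \<beta> \<le> (2 * y) powr \<beta>"
    using assms by (intro powr_mono2) auto
  then show ?thesis using True assms by (simp add: powr_mult)
next
  case False
  then have "(2 * x) powr \<beta> \<le> y powr \<beta>"
    using assms by (intro powr_mono2') auto
  then have "2 powr (- \<beta>) * (2 powr \<beta> * x powr \<beta>) \<le> 2 powr (- \<beta>) * y powr \<beta>"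
    using assms by (intro mult_left_mono) (auto simp: powr_mult)
  then show ?thesis using False by (simp add: powr_minus mult.assoc[symmetric])
qed

text \<open>The boundary distance is 1-Lipschitz, so on this disc it stays between one half and
  three halves of its value at \<open>z\<close>.\<close>

lemma bdry_dist_powr_le:
  assumes "0 < bdry_dist \<Omega> z" "dist z w < bdry_dist \<Omega> z / 2"
  shows "bdry_dist \<Omega> z powr \<beta> \<le> 2 powr \<bar>\<beta>\<bar> * bdry_dist \<Omega> w powr \<beta>"
  using bdry_dist_le_add[of \<Omega> z w] bdry_dist_le_add[of \<Omega> w z] assms
  by (intro powr_le_powr_abs_mult) (auto simp: dist_commute)

text \<open>The weight frozen at the centre is exchanged pointwise for the variable weight. The
  exponent \<beta> is free because the value estimate takes it to be \<alpha> and the derivative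
  estimate \<alpha> - 2.\<close>

lemma weight_into_ball_integral:
  assumes hol: "g holomorphic_on \<Omega>" and dom: "complex_domain \<Omega>" "\<Omega> \<noteq> UNIV" and z: "z \<in> \<Omega>"
  defines "d \<equiv> bdry_dist \<Omega> z"
  shows "ennreal (d powr \<beta>) * (\<integral>\<^sup>+w\<in>ball z (d / 2). ennreal (norm (g w) powr p) \<partial>lborel)
    \<le> ennreal (2 powr \<bar>\<beta>\<bar>) *
        (\<integral>\<^sup>+w\<in>ball z (d / 2). ennreal (norm (g w) powr p * bdry_dist \<Omega> w powr \<beta>) \<partial>lborel)"
proof -
  have d: "0 < d" unfolding d_def by (rule bdry_dist_pos[OF dom z])
  have sub: "ball z (d / 2) \<subseteq> \<Omega>"
    using ball_bdry_dist_subset[OF dom(1) z] subset_ball[of "d / 2" d z] d unfolding d_def by auto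
  have cont: "continuous_on (ball z (d / 2)) g"
    by (rule holomorphic_on_imp_continuous_on[OF holomorphic_on_subset[OF hol sub]])
  have "ennreal (d powr \<beta>) * (\<integral>\<^sup>+w\<in>ball z (d / 2). ennreal (norm (g w) powr p) \<partial>lborel)
      = (\<integral>\<^sup>+w. ennreal (d powr \<beta>) * (ennreal (norm (g w) powr p) * indicator (ball z (d / 2)) w) \<partial>lborel)"
    using borel_measurable_powr_norm_on_open[OF _ cont, of "\<lambda>_. 1" p]
    by (subst nn_integral_cmult) auto
  also have "\<dots> \<le> (\<integral>\<^sup>+w. ennreal (2 powr \<bar>\<beta>\<bar>) * (ennreal (norm (g w) powr p * bdry_dist \<Omega> w powr \<beta>)
      * indicator (ball z (d / 2)) w) \<partial>lborel)"
  proof (rule nn_integral_mono)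
    fix w
    have "d powr \<beta> * norm (g w) powr p \<le> 2 powr \<bar>\<beta>\<bar> * (norm (g w) powr p * bdry_dist \<Omega> w powr \<beta>)"
      if "w \<in> ball z (d / 2)"
      using mult_right_mono[OF bdry_dist_powr_le[of \<Omega> z w \<beta>], of "norm (g w) powr p"] that d
      by (simp add: d_def mult_ac)
    then show "ennreal (d powr \<beta>) * (ennreal (norm (g w) powr p) * indicator (ball z (d / 2)) w)
        \<le> ennreal (2 powr \<bar>\<beta>\<bar>) * (ennreal (norm (g w) powr p * bdry_dist \<Omega> w powr \<beta>)
          * indicator (ball z (d / 2)) w)"
      by (auto simp: indicator_def ennreal_mult[symmetric] intro!: ennreal_leI)
  qed
  also have "\<dots> = ennreal (2 powr \<bar>\<beta>\<bar>) *
      (\<integral>\<^sup>+w\<in>ball z (d / 2). ennreal (norm (g w) powr p * bdry_dist \<Omega> w powr \<beta>) \<partial>lborel)"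
    by (rule nn_integral_cmult) (use borel_measurable_powr_norm_on_open[OF _ cont] in auto)
  finally show ?thesis .
qed

section \<open>Weighted estimates over the domain\<close>

lemma weighted_value_le:
  assumes hol: "g holomorphic_on \<Omega>" and dom: "complex_domain \<Omega>" "\<Omega> \<noteq> UNIV" and z: "z \<in> \<Omega>"
    and p: "1 < p"
  shows "ennreal (norm (g z) powr p * bdry_dist \<Omega> z powr (\<alpha> + 2))
    \<le> ennreal (4 / pi * 2 powr \<bar>\<alpha>\<bar>) * weighted_integral \<Omega> p \<alpha> g"
proof -
  define d where "d = bdry_dist \<Omega> z"
  have d: "0 < d" unfolding d_def by (rule bdry_dist_pos[OF dom z])
  have sub: "ball z (d / 2) \<subseteq> \<Omega>"
    using ball_bdry_dist_subset[OF dom(1) z] subset_ball[of "d / 2" d z] d unfolding d_def by auto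
  \<comment> \<open>Two powers of \<open>d\<close> are spent on the area of the disc of radius
    \<open>d / 2\<close>; the factor \<open>4 / pi\<close> compensates for the rest of that
    area.\<close>
  have "norm (g z) powr p * d powr (\<alpha> + 2)
      = 4 / pi * (d powr \<alpha> * (pi * (d / 2)\<^sup>2 * norm (g z) powr p))"
    using d by (simp add: powr_add power2_eq_square powr_numeral field_simps)
  then have "ennreal (norm (g z) powr p * d powr (\<alpha> + 2))
      = ennreal (4 / pi) * (ennreal (d powr \<alpha>) * (ennreal (pi * (d / 2)\<^sup>2) * ennreal (norm (g z) powr p)))"
    by (simp only: ennreal_mult mult.assoc mult_nonneg_nonneg divide_nonneg_nonneg
        powr_ge_zero zero_le_power2 zero_le_numeral pi_ge_zero)
  also have "\<dots> \<le> ennreal (4 / pi) * (ennreal (d powr \<alpha>)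
      * (\<integral>\<^sup>+w\<in>ball z (d / 2). ennreal (norm (g w) powr p) \<partial>lborel))"
    using d p by (intro mult_left_mono powr_norm_mean_value_ball holomorphic_on_subset[OF hol sub]) auto
  also have "\<dots> \<le> ennreal (4 / pi) * (ennreal (2 powr \<bar>\<alpha>\<bar>) *
      (\<integral>\<^sup>+w\<in>ball z (d / 2). ennreal (norm (g w) powr p * bdry_dist \<Omega> w powr \<alpha>) \<partial>lborel))"
    unfolding d_def by (intro mult_left_mono weight_into_ball_integral[OF hol dom z]) auto
  also have "\<dots> \<le> ennreal (4 / pi) * (ennreal (2 powr \<bar>\<alpha>\<bar>) * weighted_integral \<Omega> p \<alpha> g)"
    unfolding weighted_integral_def by (intro mult_left_mono nn_set_integral_set_mono sub) auto
  also have "\<dots> = ennreal (4 / pi * 2 powr \<bar>\<alpha>\<bar>) * weighted_integral \<Omega> p \<alpha> g"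
    by (simp only: ennreal_mult mult.assoc divide_nonneg_nonneg powr_ge_zero zero_le_numeral pi_ge_zero)
  finally show ?thesis by (simp add: d_def)
qed

text \<open>The disc about \<open>z\<close> is enlarged to a set whose condition involves the
  boundary distance at \<open>w\<close> only. For fixed \<open>w\<close>, the admissible
  \<open>z\<close> then form a ball about \<open>w\<close>, which is the form Tonelli's theorem
  needs.\<close>

lemma weighted_deriv_le:
  assumes hol: "g holomorphic_on \<Omega>" and dom: "complex_domain \<Omega>" "\<Omega> \<noteq> UNIV" and z: "z \<in> \<Omega>"
    and p: "1 < p"
  shows "ennreal (norm (deriv g z) powr p * bdry_dist \<Omega> z powr (\<alpha> + p))
    \<le> ennreal (16 * 4 powr p / pi * 2 powr \<bar>\<alpha> - 2\<bar>) *
        (\<integral>\<^sup>+w\<in>{w \<in> \<Omega>. dist z w < bdry_dist \<Omega> w}.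
           ennreal (norm (g w) powr p * bdry_dist \<Omega> w powr (\<alpha> - 2)) \<partial>lborel)"
    (is "_ \<le> _ * ?I")
proof -
  define d where "d = bdry_dist \<Omega> z"
  have d: "0 < d" unfolding d_def by (rule bdry_dist_pos[OF dom z])
  have sub: "ball z (d / 2) \<subseteq> \<Omega>"
    using ball_bdry_dist_subset[OF dom(1) z] subset_ball[of "d / 2" d z] d unfolding d_def by auto
  \<comment> \<open>If \<open>w\<close> is within \<open>d / 2\<close> of \<open>z\<close>, its
    boundary distance exceeds \<open>d / 2\<close>, hence also \<open>dist z w\<close>.\<close>
  have sub': "ball z (d / 2) \<subseteq> {w \<in> \<Omega>. dist z w < bdry_dist \<Omega> w}"
  proof
    fix w assume w: "w \<in> ball z (d / 2)"
    then show "w \<in> {w \<in> \<Omega>. dist z w < bdry_dist \<Omega> w}"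
      using sub bdry_dist_le_add[of \<Omega> z w] by (auto simp: d_def)
  qed
  define c where "c = 16 * 4 powr p / pi"
  have c: "0 \<le> c" by (simp add: c_def)
  \<comment> \<open>With \<open>s = d / 4\<close> the doubled disc is the one of radius
    \<open>d / 2\<close>. The area absorbs \<open>d\<close> squared and costs
    \<open>16 / pi\<close>; the scaled derivative absorbs \<open>d powr p\<close> and costs
    \<open>4 powr p\<close>.\<close>
  have "norm (deriv g z) powr p * d powr (\<alpha> + p)
      = c * (d powr (\<alpha> - 2) * (pi * (d / 4)\<^sup>2 * (d / 4 * norm (deriv g z)) powr p))"
    using d by (simp add: c_def powr_add powr_diff powr_mult powr_divide power2_eq_square powr_numeral field_simps)
  then have "ennreal (norm (deriv g z) powr p * d powr (\<alpha> + p))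
      = ennreal c * (ennreal (d powr (\<alpha> - 2)) * (ennreal (pi * (d / 4)\<^sup>2)
          * ennreal ((d / 4 * norm (deriv g z)) powr p)))"
    using c by (simp add: ennreal_mult)
  also have "\<dots> \<le> ennreal c * (ennreal (d powr (\<alpha> - 2))
      * (\<integral>\<^sup>+w\<in>ball z (d / 2). ennreal (norm (g w) powr p) \<partial>lborel))"
    using powr_norm_deriv_mean_value_ball[of g z "d / 4" p] holomorphic_on_subset[OF hol sub] d p
    by (intro mult_left_mono) auto
  also have "\<dots> \<le> ennreal c * (ennreal (2 powr \<bar>\<alpha> - 2\<bar>) *
      (\<integral>\<^sup>+w\<in>ball z (d / 2). ennreal (norm (g w) powr p * bdry_dist \<Omega> w powr (\<alpha> - 2)) \<partial>lborel))"
    unfolding d_def by (intro mult_left_mono weight_into_ball_integral[OF hol dom z]) auto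
  also have "\<dots> \<le> ennreal c * (ennreal (2 powr \<bar>\<alpha> - 2\<bar>) * ?I)"
    by (intro mult_left_mono nn_set_integral_set_mono sub') auto
  also have "\<dots> = ennreal (c * 2 powr \<bar>\<alpha> - 2\<bar>) * ?I"
    using c by (simp add: ennreal_mult mult.assoc)
  finally show ?thesis by (simp add: d_def c_def)
qed

lemma weighted_integral_deriv_le:
  assumes hol: "g holomorphic_on \<Omega>" and dom: "complex_domain \<Omega>" "\<Omega> \<noteq> UNIV" and p: "1 < p"
  shows "weighted_integral \<Omega> p (\<alpha> + p) (deriv g)
    \<le> ennreal (16 * 4 powr p * 2 powr \<bar>\<alpha> - 2\<bar>) * weighted_integral \<Omega> p \<alpha> g"
proof -
  define c where "c = 16 * 4 powr p / pi * 2 powr \<bar>\<alpha> - 2\<bar>"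
  have c: "0 \<le> c" by (simp add: c_def)
  define H where "H = (\<lambda>w. ennreal (norm (g w) powr p * bdry_dist \<Omega> w powr (\<alpha> - 2)) * indicator \<Omega> w)"
  have "open \<Omega>" using dom by (simp add: complex_domain_def)
  then have H_meas[measurable]: "H \<in> borel_measurable borel"
    unfolding H_def
    by (intro borel_measurable_powr_norm_on_open holomorphic_on_imp_continuous_on[OF hol]) auto
  define k where "k = (\<lambda>z w. H w * indicator {x. dist (fst x) (snd x) < bdry_dist \<Omega> (snd x)} (z, w))"
  have k_meas[measurable]: "case_prod k \<in> borel_measurable (borel \<Otimes>\<^sub>M borel)"
    unfolding k_def by measurable
  have [measurable]: "k z \<in> borel_measurable borel" for z
    by measurable
  have "weighted_integral \<Omega> p (\<alpha> + p) (deriv g) \<le> (\<integral>\<^sup>+z. ennreal c * (\<integral>\<^sup>+w. k z w \<partial>lborel) \<partial>lborel)"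
    unfolding weighted_integral_def
  proof (rule nn_integral_mono)
    fix z
    have "(\<integral>\<^sup>+w\<in>{w \<in> \<Omega>. dist z w < bdry_dist \<Omega> w}.
           ennreal (norm (g w) powr p * bdry_dist \<Omega> w powr (\<alpha> - 2)) \<partial>lborel) = (\<integral>\<^sup>+w. k z w \<partial>lborel)"
      by (rule nn_integral_cong) (auto simp: k_def H_def indicator_def)
    then show "ennreal (norm (deriv g z) powr p * bdry_dist \<Omega> z powr (\<alpha> + p)) * indicator \<Omega> z
        \<le> ennreal c * (\<integral>\<^sup>+w. k z w \<partial>lborel)"
      using weighted_deriv_le[OF hol dom _ p, of z \<alpha>] by (cases "z \<in> \<Omega>") (auto simp: c_def)
  qed
  also have "\<dots> = ennreal c * (\<integral>\<^sup>+z. (\<integral>\<^sup>+w. k z w \<partial>lborel) \<partial>lborel)"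
    by (rule nn_integral_cmult) measurable
  also have "(\<integral>\<^sup>+z. (\<integral>\<^sup>+w. k z w \<partial>lborel) \<partial>lborel) = (\<integral>\<^sup>+w. (\<integral>\<^sup>+z. k z w \<partial>lborel) \<partial>lborel)"
    by (rule lborel_pair.Fubini'[symmetric]) measurable
  also have "\<dots> = (\<integral>\<^sup>+w. ennreal pi *
      (ennreal (norm (g w) powr p * bdry_dist \<Omega> w powr \<alpha>) * indicator \<Omega> w) \<partial>lborel)"
  proof (rule nn_integral_cong)
    fix w
    \<comment> \<open>The \<open>z\<close>-section is the full ball about \<open>w\<close>, of area
      \<open>pi\<close> times the squared boundary distance. This raises the exponent from \<alpha>
      - 2 back to \<alpha>, and its \<open>pi\<close> later cancels the one in
      \<open>c\<close>.\<close>
    have "(\<integral>\<^sup>+z. k z w \<partial>lborel) = (\<integral>\<^sup>+z. H w * indicator (ball w (bdry_dist \<Omega> w)) z \<partial>lborel)"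
      by (rule nn_integral_cong) (auto simp: k_def indicator_def dist_commute)
    also have "\<dots> = H w * ennreal (pi * (bdry_dist \<Omega> w)\<^sup>2)"
      by (subst nn_integral_cmult_indicator)
         (simp_all add: emeasure_complex_ball bdry_dist_def infdist_nonneg)
    also have "\<dots> = ennreal pi * (ennreal (norm (g w) powr p * bdry_dist \<Omega> w powr \<alpha>) * indicator \<Omega> w)"
    proof (cases "w \<in> \<Omega>")
      case True
      have "norm (g w) powr p * bdry_dist \<Omega> w powr (\<alpha> - 2) * (pi * (bdry_dist \<Omega> w)\<^sup>2)
          = pi * (norm (g w) powr p * bdry_dist \<Omega> w powr \<alpha>)"
        using bdry_dist_pos[OF dom True]
        by (simp add: powr_diff powr_numeral field_simps)
      with True show ?thesis
        by (simp add: H_def ennreal_mult[symmetric])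
    qed (simp add: H_def)
    finally show "(\<integral>\<^sup>+z. k z w \<partial>lborel)
        = ennreal pi * (ennreal (norm (g w) powr p * bdry_dist \<Omega> w powr \<alpha>) * indicator \<Omega> w)" .
  qed
  also have "\<dots> = ennreal pi * weighted_integral \<Omega> p \<alpha> g"
    unfolding weighted_integral_def using \<open>open \<Omega>\<close>
    by (intro nn_integral_cmult)
       (use borel_measurable_powr_norm_on_open[OF _ holomorphic_on_imp_continuous_on[OF hol]] in auto)
  also have "ennreal c * (ennreal pi * weighted_integral \<Omega> p \<alpha> g)
      = ennreal (16 * 4 powr p * 2 powr \<bar>\<alpha> - 2\<bar>) * weighted_integral \<Omega> p \<alpha> g"
    using c by (simp add: mult.assoc[symmetric] ennreal_mult[symmetric]) (simp add: c_def)
  finally show ?thesis .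
qed

theorem proposition2p3:
  fixes p \<alpha> :: real
  assumes "1 < p"
  shows "(\<exists>C::real. C > 0 \<and>
           (\<forall>(\<Omega>::complex set) (g::complex \<Rightarrow> complex).
              complex_domain \<Omega> \<longrightarrow> \<Omega> \<noteq> UNIV \<longrightarrow> g analytic_on \<Omega> \<longrightarrow>
              weighted_integral \<Omega> p (\<alpha> + p) (deriv g)
                \<le> ennreal C * weighted_integral \<Omega> p \<alpha> g))
       \<and> (\<exists>C::real. C > 0 \<and>
           (\<forall>(\<Omega>::complex set) (g::complex \<Rightarrow> complex).
              complex_domain \<Omega> \<longrightarrow> \<Omega> \<noteq> UNIV \<longrightarrow> g analytic_on \<Omega> \<longrightarrow>
              (\<forall>z\<^sub>0\<in>\<Omega>.
                ennreal (norm (g z\<^sub>0) powr p * bdry_dist \<Omega> z\<^sub>0 powr (\<alpha> + 2))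
                  + weighted_integral \<Omega> p (\<alpha> + p) (deriv g)
                \<le> ennreal C * weighted_integral \<Omega> p \<alpha> g)))"
proof -
  \<comment> \<open>Both constants involve only \<open>p\<close> and \<alpha>: \<open>C\<close>
    comes from the derivative integral, \<open>D\<close> from the value at a point, and their sum
    serves the second claim.\<close>
  define C where "C = 16 * 4 powr p * 2 powr \<bar>\<alpha> - 2\<bar>"
  define D where "D = 4 / pi * 2 powr \<bar>\<alpha>\<bar>"
  have C: "0 < C" and D: "0 < D" by (simp_all add: C_def D_def)
  have deriv_le: "weighted_integral \<Omega> p (\<alpha> + p) (deriv g) \<le> ennreal C * weighted_integral \<Omega> p \<alpha> g"
    if "complex_domain \<Omega>" "\<Omega> \<noteq> UNIV" "g analytic_on \<Omega>" for \<Omega> g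
    unfolding C_def using that assms
    by (intro weighted_integral_deriv_le analytic_imp_holomorphic)
  have both_le: "ennreal (norm (g z) powr p * bdry_dist \<Omega> z powr (\<alpha> + 2))
      + weighted_integral \<Omega> p (\<alpha> + p) (deriv g) \<le> ennreal (D + C) * weighted_integral \<Omega> p \<alpha> g"
    if "complex_domain \<Omega>" "\<Omega> \<noteq> UNIV" "g analytic_on \<Omega>" "z \<in> \<Omega>" for \<Omega> g z
  proof -
    have "ennreal (norm (g z) powr p * bdry_dist \<Omega> z powr (\<alpha> + 2)) \<le> ennreal D * weighted_integral \<Omega> p \<alpha> g"
      unfolding D_def using that assms by (intro weighted_value_le analytic_imp_holomorphic)
    from add_mono[OF this deriv_le] that C D show ?thesis
      by (simp add: distrib_right)
  qed
  show ?thesis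
    using C D deriv_le both_le by (intro conjI exI[of _ C] exI[of _ "D + C"]) auto
qed

end
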